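(* Let $p=(p_0,p_1,\ldots)$ be a critical offspring distribution (mean $\mu=1$, $p_1\neq 1$), let $\tau$ be a Galton-Watson tree with offspring distribution $p$, and let $\tau^*$ be the immortal tree associated with $p$. Let $A:\mathbb{T}_0\to\mathbb{Z}_+$ be a function such that $\mathbf{P}[A(\tau)>n]>0$ for all $n$ and such that the monotonicity property $$A(\mathbf{t}_{(b),i})\le A(\mathbf{t})\quad\text{for all }\mathbf{t}\in\mathbb{T}_0,\ b\in\mathbb{N},\ 1\le i\le Y_b(\mathbf{t})$$ holds. Then, as $n\to\infty$, the conditional distribution of $\tau$ given $\{A(\tau)>n\}$ converges to the distribution of $\tau^*$ (local convergence): $$\mathrm{dist}(\tau\mid A(\tau)>n)\to \mathrm{dist}(\tau^* ).$$
   Context: $\mathbb{Z}_+=\{0,1,2,\ldots\}$, $\mathbb{N}=\{1,2,\ldots\}$. Trees are rooted ordered trees in Neveu's formalism: a tree $\mathbf{t}$ is a set of finite sequences of positive integers containing the empty sequence $\emptyset$ (the root), closed under taking prefixes (ancestors), such that for each $u\in\mathbf{t}$ there is $k_u(\mathbf{t})\in\mathbb{Z}_+$ (the out-degree) with $ui\in\mathbf{t}$ iff $1\le i\le k_u(\mathbf{t})$. $|u|$ is the length (height) of $u$. $\mathbb{T}$ is the set of trees, $\mathbb{T}_0$ the set of finite trees. $H(\mathbf{t})=\sup\{|u|:u\in\mathbf{t}\}$, $\mathbb{T}^{(h)}=\{\mathbf{t}:H(\mathbf{t})\le h\}$, $r_h(\mathbf{t})=\{u\in\mathbf{t}:|u|\le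 h\}$. $Y_b(\mathbf{t})$ is the number of nodes of $\mathbf{t}$ at height $b$, and $\mathbf{t}_{(b),i}$, $1\le i\le Y_b(\mathbf{t})$, are the subtrees above height $b$: if $u_1,u_2,\ldots$ are the nodes at height $b$ in order, $\mathbf{t}_{(b),i}=\{v:u_iv\in\mathbf{t}\}$. Convergence in distribution of $\mathbb{T}$-valued random variables is with respect to the distance $d(\mathbf{t},\mathbf{t}')=2^{-\sup\{h\in\mathbb{Z}_+:r_h(\mathbf{t})=r_h(\mathbf{t}')\}}$; equivalently, $T_n\to T$ in distribution iff $\mathbf{P}[r_h(T_n)=\mathbf{t}]\to\mathbf{P}[r_h(T)=\mathbf{t}]$ for all $h\in\mathbb{N}$ and $\mathbf{t}\in\mathbb{T}^{(h)}$. A Galton-Watson tree $\tau$ with offspring distribution $p$ is a random tree in which the out-degree of the root has law $p$ and, conditionally on it being $n$, the $n$ subtrees above height 1 are independent and distributed as $\tau$. If $p$ has mean $\mu\le1$, $\mu>0$, $p_1\ne1$, then $\tau\in\mathbb{T}_0$ a.s. The immortal tree $\tau^*$ of $p$: nodes are normal or special; the root is special; normal nodes have offspring distribution $p$, special nodes have the size-biased offspring distribution $\hat p_k=kp_k/\mu$; the offspring numbers of all nodes are independent; all children of a normal node are normal; among the children of a special node one chosen uniformly at random is special and the others are normal. *)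

theory Defs
  imports "HOL-Probability.Probability" "HOL-Library.List_Lexorder"
begin

definition is_tree :: "nat list set \<Rightarrow> bool" where
  "is_tree t \<longleftrightarrow> t \<subseteq> lists {1..} \<and> [] \<in> t \<and> (\<forall>u v. u @ v \<in> t \<longrightarrow> u \<in> t) \<and>
     (\<forall>u\<in>t. \<exists>k. \<forall>i. u @ [i] \<in> t \<longleftrightarrow> 1 \<le> i \<and> i \<le> k)"

typedef otree = "{t. is_tree t}" morphisms nodes Tree
proof -
  have "is_tree {[]}" by (auto simp: is_tree_def intro: exI[of _ 0])
  then show ?thesis by blast
qed

lemma is_tree_nodes: "is_tree (nodes t)"
  using nodes by simp

lemma nodes_Tree: "is_tree t \<Longrightarrow> nodes (Tree t) = t"
  by (simp add: Tree_inverse)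

definition finite_tree :: "otree \<Rightarrow> bool" where
  "finite_tree t \<longleftrightarrow> finite (nodes t)"

text \<open>Only meaningful for nodes \<open>u\<close> of \<open>t\<close>.\<close>
definition outdeg :: "otree \<Rightarrow> nat list \<Rightarrow> nat" where
  "outdeg t u = (THE k. \<forall>i. u @ [i] \<in> nodes t \<longleftrightarrow> 1 \<le> i \<and> i \<le> k)"

lemma outdeg_iff:
  assumes "u \<in> nodes t"
  shows "u @ [i] \<in> nodes t \<longleftrightarrow> 1 \<le> i \<and> i \<le> outdeg t u"
proof -
  obtain k where k: "\<forall>i. u @ [i] \<in> nodes t \<longleftrightarrow> 1 \<le> i \<and> i \<le> k"
    using is_tree_nodes[of t] assms unfolding is_tree_def by blast
  have "outdeg t u = k" unfolding outdeg_def
  proof (rule the_equality)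
    show "\<forall>i. u @ [i] \<in> nodes t \<longleftrightarrow> 1 \<le> i \<and> i \<le> k" by (fact k)
    fix k' assume k': "\<forall>i. u @ [i] \<in> nodes t \<longleftrightarrow> 1 \<le> i \<and> i \<le> k'"
    have *: "(1 \<le> i \<and> i \<le> k) = (1 \<le> i \<and> i \<le> k')" for i using k k' by simp
    from *[of k] *[of k'] show "k' = k" by (cases k; cases k') auto
  qed
  with k show ?thesis by simp
qed

definition restr :: "nat \<Rightarrow> otree \<Rightarrow> otree" where
  "restr h t = Tree {u \<in> nodes t. length u \<le> h}"

lemma nodes_restr: "nodes (restr h t) = {u \<in> nodes t. length u \<le> h}"
  unfolding restr_def
proof (rule nodes_Tree, unfold is_tree_def, intro conjI allI ballI impI)
  fix u assume u: "u \<in> {u \<in> nodes t. length u \<le> h}"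
  show "\<exists>k. \<forall>i. u @ [i] \<in> {u \<in> nodes t. length u \<le> h} \<longleftrightarrow> 1 \<le> i \<and> i \<le> k"
  proof (cases "length u < h")
    case True
    with u outdeg_iff[of u t] show ?thesis by (intro exI[of _ "outdeg t u"]) auto
  next
    case False
    then show ?thesis by (intro exI[of _ 0]) auto
  qed
qed (use is_tree_nodes[of t] in \<open>auto simp: is_tree_def\<close>)

text \<open>For \<open>u \<in> nodes t\<close>.\<close>
definition subtree :: "otree \<Rightarrow> nat list \<Rightarrow> otree" where
  "subtree t u = Tree {v. u @ v \<in> nodes t}"

lemma nodes_subtree:
  assumes "u \<in> nodes t"
  shows "nodes (subtree t u) = {v. u @ v \<in> nodes t}"
  unfolding subtree_def
proof (rule nodes_Tree, unfold is_tree_def, intro conjI allI ballI impI)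
  have t: "\<And>x. x \<in> nodes t \<Longrightarrow> x \<in> lists {1..}" "\<And>x y. x @ y \<in> nodes t \<Longrightarrow> x \<in> nodes t"
    using is_tree_nodes[of t] unfolding is_tree_def by blast+
  show "{v. u @ v \<in> nodes t} \<subseteq> lists {1..}" using t(1) by fastforce
  show "[] \<in> {v. u @ v \<in> nodes t}" using assms by simp
  show "x \<in> {v. u @ v \<in> nodes t}" if "x @ y \<in> {v. u @ v \<in> nodes t}" for x y
    using that t(2)[of "u @ x" y] by simp
  show "\<exists>k. \<forall>i. x @ [i] \<in> {v. u @ v \<in> nodes t} \<longleftrightarrow> 1 \<le> i \<and> i \<le> k"
    if "x \<in> {v. u @ v \<in> nodes t}" for x
    using that outdeg_iff[of "u @ x" t] by (intro exI[of _ "outdeg t (u @ x)"]) auto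
qed

definition level :: "nat \<Rightarrow> otree \<Rightarrow> nat list set" where
  "level b t = {u \<in> nodes t. length u = b}"

definition level_size :: "nat \<Rightarrow> otree \<Rightarrow> nat" where
  "level_size b t = card (level b t)"

text \<open>The nodes at height \<open>b\<close> are enumerated in lexicographic order; the \<open>i\<close>th subtree, with
  \<open>1 \<le> i \<le> level_size b t\<close>, is the one rooted at position \<open>i - 1\<close> of the (0-based) list.\<close>
definition subtree_above :: "nat \<Rightarrow> nat \<Rightarrow> otree \<Rightarrow> otree" where
  "subtree_above b i t = subtree t (sorted_list_of_set (level b t) ! (i - 1))"

lemma finite_level: "finite (level b t)"
proof (induction b)
  case 0
  have "level 0 t \<subseteq> {[]}" by (auto simp: level_def)
  then show ?case by (rule finite_subset) simp
next
  case (Suc b)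
  have "level (Suc b) t \<subseteq> (\<Union>u\<in>level b t. (\<lambda>i. u @ [i]) ` {..outdeg t u})"
  proof
    fix x assume x: "x \<in> level (Suc b) t"
    then obtain u i where ui: "x = u @ [i]" by (cases x rule: rev_cases) (auto simp: level_def)
    have "u \<in> nodes t" using x is_tree_nodes[of t] unfolding ui level_def is_tree_def by blast
    with x ui outdeg_iff[of u t i] show "x \<in> (\<Union>u\<in>level b t. (\<lambda>i. u @ [i]) ` {..outdeg t u})"
      by (auto simp: level_def)
  qed
  then show ?case by (rule finite_subset) (use Suc in auto)
qed

lemma subtree_above_1:
  assumes "1 \<le> i" "i \<le> outdeg t []"
  shows "subtree_above 1 i t = subtree t [i]"
proof -
  let ?l = "map (\<lambda>i. [i]) [1..<Suc (outdeg t [])]"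
  have root: "[] \<in> nodes t" using is_tree_nodes[of t] unfolding is_tree_def by blast
  have "level 1 t = set ?l"
  proof (intro set_eqI iffI)
    fix x assume x: "x \<in> level 1 t"
    then obtain i where "x = [i]" by (auto simp: level_def length_Suc_conv)
    with x outdeg_iff[OF root, of i] show "x \<in> set ?l" by (auto simp: level_def)
  next
    fix x assume "x \<in> set ?l"
    then obtain i where "x = [i]" "1 \<le> i" "i \<le> outdeg t []" by auto
    with outdeg_iff[OF root, of i] show "x \<in> level 1 t" by (simp add: level_def)
  qed
  moreover have "sorted_wrt (<) ?l"
  proof -
    have "sorted_wrt (<) [m..<n]" for m n :: nat by simp
    moreover have "[i] < [j]" if "i < j" for i j :: nat using that by simp
    ultimately show ?thesis unfolding sorted_wrt_map by (metis (no_types, lifting) sorted_wrt_mono_rel)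
  qed
  ultimately have "sorted_list_of_set (level 1 t) = ?l"
    by (metis sorted_list_of_set.idem_if_sorted_distinct strict_sorted_iff)
  moreover have "?l ! (i - 1) = [i]" using assms by (subst nth_map) (auto simp del: upt_Suc)
  ultimately show ?thesis by (simp only: subtree_above_def)
qed

instantiation otree :: metric_space
begin

text \<open>For \<open>t = t'\<close> the supremum is infinite, whence distance 0; otherwise the set is finite.\<close>
definition dist_otree :: "otree \<Rightarrow> otree \<Rightarrow> real" where
  "dist_otree t t' = (if t = t' then 0 else (1/2) ^ Sup {h. restr h t = restr h t'})"

definition uniformity_otree :: "(otree \<times> otree) filter" where
  "uniformity_otree = (INF e\<in>{0<..}. principal {(x, y). dist x y < e})"

definition open_otree :: "otree set \<Rightarrow> bool" where
  "open_otree U \<longleftrightarrow> (\<forall>x\<in>U. \<forall>\<^sub>F (x', y) in uniformity. x' = x \<longrightarrow> y \<in> U)"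

lemma restr_0: "restr 0 t = restr 0 t'"
proof -
  have "nodes (restr 0 t) = {[]}" for t
    using is_tree_nodes[of t] by (auto simp: nodes_restr is_tree_def)
  then show ?thesis by (simp flip: nodes_inject)
qed

lemma restr_mono:
  assumes "restr h t = restr h t'" "k \<le> h"
  shows "restr k t = restr k t'"
proof -
  have "nodes (restr h t) = nodes (restr h t')" using assms by simp
  then have "nodes (restr k t) = nodes (restr k t')" using assms(2) unfolding nodes_restr
    by (smt (verit) Collect_cong le_trans mem_Collect_eq)
  then show ?thesis by (simp add: nodes_inject)
qed

lemma restr_differ: assumes "t \<noteq> t'" obtains h where "restr h t \<noteq> restr h t'"
proof -
  have "nodes t \<noteq> nodes t'" using assms by (simp add: nodes_inject)
  then obtain u where u: "(u \<in> nodes t) \<noteq> (u \<in> nodes t')" by blast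
  then have "nodes (restr (length u) t) \<noteq> nodes (restr (length u) t')"
    unfolding nodes_restr by blast
  then show ?thesis using that by metis
qed

lemma finite_agree: assumes "t \<noteq> t'" shows "finite {h. restr h t = restr h t'}"
proof -
  obtain h where "restr h t \<noteq> restr h t'" using restr_differ[OF assms] .
  then have "k \<le> h" if "restr k t = restr k t'" for k
    using restr_mono[OF that, of h] by (meson nat_le_linear)
  then have "{h. restr h t = restr h t'} \<subseteq> {..h}" by auto
  then show ?thesis by (rule finite_subset) simp
qed

lemma dist_otree_lt_iff: "dist t t' < (1/2) ^ h \<longleftrightarrow> restr (Suc h) t = restr (Suc h) t'"
proof (cases "t = t'")
  case False
  let ?S = "{h. restr h t = restr h t'}"
  have "0 \<in> ?S" using restr_0 by blast
  then have S: "?S \<noteq> {}" "finite ?S" using finite_agree[OF False] by auto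
  have "Max ?S \<in> ?S" using S Max_in by blast
  then have "h < Max ?S \<longleftrightarrow> Suc h \<in> ?S"
    using restr_mono[of "Max ?S" t t' "Suc h"] Max_ge[OF S(2), of "Suc h"] by auto
  then show ?thesis using False S by (simp add: dist_otree_def Sup_nat_def)
qed (simp add: dist_otree_def)

instance
proof
  fix x y z :: otree
  show "dist x y = 0 \<longleftrightarrow> x = y" by (simp add: dist_otree_def)
  show "dist x y \<le> dist x z + dist y z"
  proof (cases "x = y \<or> x = z \<or> y = z")
    case True
    moreover have "{h. restr h x = restr h y} = {h. restr h y = restr h x}" by auto
    ultimately show ?thesis by (elim disjE) (simp_all add: dist_otree_def)
  next
    case False
    let ?S = "\<lambda>x y. {h. restr h x = restr h y}"
    have ne: "?S a b \<noteq> {}" for a b using restr_0[of a b] by blast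
    let ?m = "min (Max (?S x z)) (Max (?S y z))"
    have "Max (?S x z) \<in> ?S x z" "Max (?S y z) \<in> ?S y z"
      using False ne finite_agree Max_in by blast+
    then have "restr ?m x = restr ?m z" "restr ?m y = restr ?m z"
      using restr_mono by (metis (mono_tags) mem_Collect_eq min.cobounded1 min.cobounded2)+
    then have "?m \<le> Max (?S x y)" using False finite_agree by (intro Max_ge) auto
    then have "(1/2::real) ^ Max (?S x y) \<le> (1/2) ^ ?m" by (intro power_decreasing) auto
    also have "\<dots> \<le> (1/2) ^ Max (?S x z) + (1/2) ^ Max (?S y z)"
      by (simp add: min_def)
    finally have "(1/2::real) ^ Sup (?S x y) \<le> (1/2) ^ Sup (?S x z) + (1/2) ^ Sup (?S y z)"
      by (simp only: Sup_nat_def ne if_False)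
    then show ?thesis using False by (simp add: dist_otree_def)
  qed
qed (auto simp: uniformity_otree_def open_otree_def)

end

text \<open>Weak convergence of measures, i.e. convergence in distribution.\<close>
definition weakly_converges :: "(nat \<Rightarrow> 'a::metric_space measure) \<Rightarrow> 'a measure \<Rightarrow> bool" where
  "weakly_converges P Q \<longleftrightarrow>
     (\<forall>f :: 'a \<Rightarrow> real. continuous_on UNIV f \<longrightarrow> bounded (range f) \<longrightarrow>
        (\<lambda>n. \<integral>t. f t \<partial>P n) \<longlonglongrightarrow> (\<integral>t. f t \<partial>Q))"

text \<open>A nonzero value of this Bochner integral implies that the mean is finite.\<close>
definition offspring_mean :: "nat pmf \<Rightarrow> real" where
  "offspring_mean p = measure_pmf.expectation p real"

definition galton_watson_tree :: "nat pmf \<Rightarrow> 'w measure \<Rightarrow> ('w \<Rightarrow> otree) \<Rightarrow> bool" where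
  "galton_watson_tree p M \<tau> \<longleftrightarrow>
     prob_space M \<and> \<tau> \<in> borel_measurable M \<and>
     (\<forall>n. measure M {\<omega> \<in> space M. outdeg (\<tau> \<omega>) [] = n} = pmf p n) \<and>
     (\<forall>n. pmf p n > 0 \<longrightarrow>
        (let C = uniform_measure M {\<omega> \<in> space M. outdeg (\<tau> \<omega>) [] = n} in
           prob_space.indep_vars C (\<lambda>_. borel) (\<lambda>i \<omega>. subtree_above 1 i (\<tau> \<omega>)) {1..n} \<and>
           (\<forall>i\<in>{1..n}. distr C borel (\<lambda>\<omega>. subtree_above 1 i (\<tau> \<omega>)) = distr M borel \<tau>)))"

definition size_biased :: "nat pmf \<Rightarrow> nat pmf" where
  "size_biased p = embed_pmf (\<lambda>k. real k * pmf p k / offspring_mean p)"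

lemma pmf_size_biased:
  assumes "offspring_mean p > 0"
  shows "pmf (size_biased p) k = real k * pmf p k / offspring_mean p"
  unfolding size_biased_def
proof (rule pmf_embed_pmf)
  show "0 \<le> real k * pmf p k / offspring_mean p" for k using assms by simp
  have int: "integrable (measure_pmf p) real"
    using assms not_integrable_integral_eq unfolding offspring_mean_def by fastforce
  have "(\<integral>\<^sup>+k. ennreal (real k * pmf p k / offspring_mean p) \<partial>count_space UNIV)
      = (\<integral>\<^sup>+k. ennreal (pmf p k) * ennreal (real k / offspring_mean p) \<partial>count_space UNIV)"
    using assms by (intro nn_integral_cong) (simp flip: ennreal_mult add: mult_ac)
  also have "\<dots> = (\<integral>\<^sup>+k. ennreal (real k / offspring_mean p) \<partial>measure_pmf p)"
    by (simp add: nn_integral_measure_pmf)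
  also have "\<dots> = ennreal (\<integral>k. real k / offspring_mean p \<partial>measure_pmf p)"
    using assms int by (intro nn_integral_eq_integral) auto
  also have "\<dots> = 1" using assms by (simp add: offspring_mean_def)
  finally show "(\<integral>\<^sup>+k. ennreal (real k * pmf p k / offspring_mean p) \<partial>count_space UNIV) = 1" .
qed

text \<open>Each potential node \<open>u\<close> carries \<open>(k, k', j)\<close>: its offspring number \<open>k\<close> if it is normal, its
  offspring number \<open>k'\<close> if it is special, and in the latter case the index \<open>j\<close> of its special child.\<close>
definition node_law :: "nat pmf \<Rightarrow> (nat \<times> nat \<times> nat) pmf" where
  "node_law p =
     pair_pmf p (bind_pmf (size_biased p) (\<lambda>k'. map_pmf (\<lambda>j. (k', j)) (pmf_of_set {1..k'})))"

definition special :: "(nat list \<Rightarrow> nat \<times> nat \<times> nat) \<Rightarrow> nat list \<Rightarrow> bool" where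
  "special \<omega> u \<longleftrightarrow> (\<forall>l<length u. u ! l = snd (snd (\<omega> (take l u))))"

definition offspring :: "(nat list \<Rightarrow> nat \<times> nat \<times> nat) \<Rightarrow> nat list \<Rightarrow> nat" where
  "offspring \<omega> u = (if special \<omega> u then fst (snd (\<omega> u)) else fst (\<omega> u))"

definition immortal_tree :: "(nat list \<Rightarrow> nat \<times> nat \<times> nat) \<Rightarrow> otree" where
  "immortal_tree \<omega> = Tree {u. \<forall>l<length u. 1 \<le> u ! l \<and> u ! l \<le> offspring \<omega> (take l u)}"

definition immortal_tree_law :: "nat pmf \<Rightarrow> otree measure" where
  "immortal_tree_law p = distr (\<Pi>\<^sub>M u\<in>UNIV. measure_pmf (node_law p)) borel immortal_tree"

lemma nodes_immortal_tree:
  "nodes (immortal_tree \<omega>) = {u. \<forall>l<length u. 1 \<le> u ! l \<and> u ! l \<le> offspring \<omega> (take l u)}"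
  unfolding immortal_tree_def
proof (rule nodes_Tree, unfold is_tree_def, intro conjI allI ballI impI)
  let ?T = "{u. \<forall>l<length u. 1 \<le> u ! l \<and> u ! l \<le> offspring \<omega> (take l u)}"
  show "?T \<subseteq> lists {1..}" by (auto simp: in_set_conv_nth)
  show "[] \<in> ?T" by simp
  show "u \<in> ?T" if "u @ v \<in> ?T" for u v
  proof (clarsimp)
    fix l assume l: "l < length u"
    have *: "1 \<le> (u @ v) ! m \<and> (u @ v) ! m \<le> offspring \<omega> (take m (u @ v))"
      if "m < length (u @ v)" for m using \<open>u @ v \<in> ?T\<close> that by blast
    from l *[of l] show "Suc 0 \<le> u ! l \<and> u ! l \<le> offspring \<omega> (take l u)"
      by (simp add: nth_append)
  qed
  show "\<exists>k. \<forall>i. u @ [i] \<in> ?T \<longleftrightarrow> 1 \<le> i \<and> i \<le> k" if "u \<in> ?T" for u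
    using that by (intro exI[of _ "offspring \<omega> u"]) (auto simp: nth_append less_Suc_eq)
qed

lemma borel_measurable_otreeI:
  assumes "\<And>u. {\<omega> \<in> space M. u \<in> nodes (f \<omega>)} \<in> sets M"
  shows "f \<in> borel_measurable M"
proof (rule borel_measurableI)
  fix S :: "otree set" assume S: "open S"
  define C where "C = (\<lambda>(h, s). {t. restr h t = s})"
  have cyl: "f -` C (h, s) \<inter> space M \<in> sets M" for h s
  proof -
    have "{\<omega> \<in> space M. \<forall>u. (u \<in> nodes (f \<omega>) \<and> length u \<le> h) = (u \<in> nodes s)} \<in> sets M"
    proof (rule sets.sets_Collect_countable_All)
      fix u
      have "{\<omega> \<in> space M. (u \<in> nodes (f \<omega>) \<and> length u \<le> h) = (u \<in> nodes s)}
        = (if length u \<le> h then if u \<in> nodes s then {\<omega> \<in> space M. u \<in> nodes (f \<omega>)}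
             else space M - {\<omega> \<in> space M. u \<in> nodes (f \<omega>)}
           else if u \<in> nodes s then {} else space M)" by auto
      then show "{\<omega> \<in> space M. (u \<in> nodes (f \<omega>) \<and> length u \<le> h) = (u \<in> nodes s)} \<in> sets M"
        using assms[of u] by simp
    qed
    also have "{\<omega> \<in> space M. \<forall>u. (u \<in> nodes (f \<omega>) \<and> length u \<le> h) = (u \<in> nodes s)}
        = f -` C (h, s) \<inter> space M"
      by (auto simp: C_def nodes_restr simp flip: nodes_inject)
    finally show ?thesis .
  qed
  have cnt: "countable (range (restr h))" for h
  proof -
    have "nodes (restr h t) = (\<Union>b\<le>h. level b t)" for t by (auto simp: nodes_restr level_def)
    then have "nodes ` range (restr h) \<subseteq> {X. finite X}" by (auto simp: finite_level)
    moreover have "countable {X :: nat list set. finite X}" by (rule countable_Collect_finite)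
    ultimately have "countable (nodes ` range (restr h))" by (rule countable_subset)
    then show ?thesis by (rule countable_image_inj_on) (simp add: inj_on_def nodes_inject)
  qed
  define I where "I = {(h, s). s \<in> range (restr h) \<and> C (h, s) \<subseteq> S}"
  have "I \<subseteq> (SIGMA h:UNIV. range (restr h))" by (auto simp: I_def)
  then have I: "countable I" by (rule countable_subset) (simp add: cnt)
  have "S = (\<Union>x\<in>I. C x)"
  proof (intro equalityI subsetI)
    fix t assume "t \<in> S"
    then obtain e where e: "e > 0" "\<And>t'. dist t' t < e \<Longrightarrow> t' \<in> S"
      using S unfolding open_dist by blast
    obtain h where "(1/2::real) ^ h < e" using real_arch_pow_inv[of e "1/2"] e(1) by auto
    then have "t' \<in> S" if "restr (Suc h) t' = restr (Suc h) t" for t'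
      using that e(2)[of t'] dist_otree_lt_iff[of t' t h] by simp
    then have "(Suc h, restr (Suc h) t) \<in> I" by (auto simp: I_def C_def)
    then show "t \<in> (\<Union>x\<in>I. C x)" by (force simp: C_def)
  qed (auto simp: I_def)
  then have "f -` S \<inter> space M = (\<Union>x\<in>I. f -` C x \<inter> space M)" by blast
  also have "\<dots> \<in> sets M" using I cyl by (intro sets.countable_UN'') auto
  finally show "f -` S \<inter> space M \<in> sets M" .
qed

lemma measurable_immortal_tree:
  "immortal_tree \<in> borel_measurable (\<Pi>\<^sub>M u\<in>UNIV. measure_pmf (node_law p))"
proof (rule borel_measurable_otreeI)
  fix u
  let ?P = "\<Pi>\<^sub>M u\<in>UNIV. measure_pmf (node_law p)"
  have comp: "(\<lambda>\<omega>. g (\<omega> v)) \<in> measurable ?P (count_space UNIV)" for g :: "_ \<Rightarrow> nat" and v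
    by (rule measurable_compose[OF measurable_component_singleton]) auto
  have [measurable]: "(\<lambda>\<omega>. fst (\<omega> v)) \<in> measurable ?P (count_space UNIV)"
    "(\<lambda>\<omega>. fst (snd (\<omega> v))) \<in> measurable ?P (count_space UNIV)"
    "(\<lambda>\<omega>. snd (snd (\<omega> v))) \<in> measurable ?P (count_space UNIV)" for v
    by (rule comp)+
  show "{\<omega> \<in> space ?P. u \<in> nodes (immortal_tree \<omega>)} \<in> sets ?P"
    unfolding nodes_immortal_tree offspring_def special_def mem_Collect_eq by measurable
qed

end

theory Submission
  imports Defs
begin

text \<open>
  Let \<open>Q\<close> be the law of \<open>\<tau>\<close>, let \<open>B n\<close> be the set of finite trees \<open>t\<close> with \<open>A t > n\<close>, and put
  \<open>q n = Q (B n)\<close>. For a tree \<open>s\<close> of height at most \<open>h\<close>, write \<open>w\<close> for the product of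
  \<open>pmf p (outdeg s v)\<close> over the nodes \<open>v\<close> below height \<open>h\<close> (\<open>weight p h s\<close>), and \<open>k\<close> for the
  number of nodes of \<open>s\<close> at height \<open>h\<close>. The proof rests on one lower bound and one upper bound.

  \<^item> By the branching property, \<open>\<tau>\<close> agrees with \<open>s\<close> up to height \<open>h\<close> with probability \<open>w\<close>, and its
    \<open>k\<close> subtrees above height \<open>h\<close> all avoid \<open>B n\<close> with conditional probability \<open>(1 - q n) ^ k\<close>
    (\<open>prob_grafted\<close>). If one of them lies in \<open>B n\<close> and \<open>\<tau>\<close> is finite, then monotonicity puts \<open>\<tau>\<close>
    in \<open>B n\<close>. As \<open>\<tau>\<close> is almost surely finite, the conditional probability of the cylinder given
    \<open>B n\<close> is at least \<open>w * (1 - (1 - q n) ^ k) / q n\<close>, which tends to \<open>k * w\<close> because \<open>q n\<close> tends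
    to \<open>0\<close> (\<open>conditional_cylinder_ge\<close>).

  \<^item> The immortal tree agrees with \<open>s\<close> up to height \<open>h\<close> with probability at most \<open>k * w\<close>: for each
    of the \<open>k\<close> possible positions of the special node at height \<open>h\<close>, the factors \<open>1 / j\<close> from the
    uniform choice cancel the factors \<open>j\<close> from the size-biasing (\<open>immortal_cylinder_le\<close>).

  So the limes inferior of the conditional cylinder probabilities dominates those of the immortal
  tree. Since the latter is a probability measure, no mass can be left over, and this one-sided
  estimate already implies weak convergence (\<open>weakly_converges_otreeI\<close>). In particular the matching
  upper bound for conditional probabilities is not needed.

  Almost sure finiteness is obtained without any limit: the probability \<open>f\<close> of a finite tree is a
  fixed point of the generating function of \<open>p\<close>, it is positive because \<open>q n\<close> is, and strict
  convexity at mean \<open>1\<close> leaves only \<open>f = 1\<close> (\<open>extinction\<close>).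
\<close>

section \<open>Decomposition of trees at the root\<close>

lemma Nil_in_nodes [simp]: "[] \<in> nodes t"
  using is_tree_nodes[of t] by (simp add: is_tree_def)

lemma nodes_prefix: "u @ v \<in> nodes t \<Longrightarrow> u \<in> nodes t"
  using is_tree_nodes[of t] unfolding is_tree_def by blast

lemma single_in_nodes_iff: "[i] \<in> nodes t \<longleftrightarrow> i \<in> {1..outdeg t []}"
  using outdeg_iff[of "[]" t i] by simp

lemma outdeg_unique:
  assumes "u \<in> nodes t" "\<And>i. u @ [i] \<in> nodes t \<longleftrightarrow> 1 \<le> i \<and> i \<le> k"
  shows "outdeg t u = k"
proof -
  have *: "(1 \<le> i \<and> i \<le> outdeg t u) = (1 \<le> i \<and> i \<le> k)" for i
    using assms outdeg_iff[of u t i] by simp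
  from *[of k] *[of "outdeg t u"] show ?thesis by (cases k; cases "outdeg t u") auto
qed

lemma outdeg_subtree:
  assumes "u @ v \<in> nodes t"
  shows "outdeg (subtree t u) v = outdeg t (u @ v)"
  using assms outdeg_iff[OF assms] nodes_subtree[OF nodes_prefix[OF assms]]
  by (intro outdeg_unique) auto

lemma outdeg_restr:
  assumes "u \<in> nodes t" "length u < h"
  shows "outdeg (restr h t) u = outdeg t u"
  using assms outdeg_iff[OF assms(1)] by (intro outdeg_unique) (auto simp: nodes_restr)

lemma subtree_Nil [simp]: "subtree t [] = t"
  by (simp add: nodes_subtree flip: nodes_inject)

lemma subtree_subtree:
  assumes "u @ v \<in> nodes t"
  shows "subtree (subtree t u) v = subtree t (u @ v)"
  using assms nodes_prefix[OF assms] by (simp add: nodes_subtree flip: nodes_inject)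

lemma Cons_in_nodes_iff:
  "i # v \<in> nodes t \<longleftrightarrow> i \<in> {1..outdeg t []} \<and> v \<in> nodes (subtree t [i])"
  using nodes_prefix[of "[i]" v t] nodes_subtree[of "[i]" t] single_in_nodes_iff[of i t] by auto

lemma nodes_decomp:
  "nodes t = insert [] (\<Union>i\<in>{1..outdeg t []}. Cons i ` nodes (subtree t [i]))"
proof (intro set_eqI)
  fix u show "u \<in> nodes t \<longleftrightarrow>
      u \<in> insert [] (\<Union>i\<in>{1..outdeg t []}. Cons i ` nodes (subtree t [i]))"
    by (cases u) (auto simp: Cons_in_nodes_iff)
qed

lemma level_Suc: "level (Suc h) t = (\<Union>i\<in>{1..outdeg t []}. Cons i ` level h (subtree t [i]))"
  unfolding level_def by (subst nodes_decomp) auto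

lemma level_size_Suc: "level_size (Suc h) t = (\<Sum>i=1..outdeg t []. level_size h (subtree t [i]))"
proof -
  have "card (\<Union>i\<in>{1..outdeg t []}. Cons i ` level h (subtree t [i]))
      = (\<Sum>i=1..outdeg t []. card (Cons i ` level h (subtree t [i])))"
    by (rule card_UN_disjoint) (auto simp: finite_level)
  then show ?thesis by (simp add: level_size_def level_Suc card_image)
qed

lemma finite_tree_iff:
  "finite_tree t \<longleftrightarrow> (\<forall>i\<in>{1..outdeg t []}. finite_tree (subtree t [i]))"
  unfolding finite_tree_def by (subst nodes_decomp) (auto simp: finite_image_iff)

lemma otree_eq_iff:
  "t = s \<longleftrightarrow> outdeg t [] = outdeg s [] \<and> (\<forall>i\<in>{1..outdeg s []}. subtree t [i] = subtree s [i])"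
  (is "_ \<longleftrightarrow> ?R")
proof
  assume ?R
  then have "nodes t = nodes s" by (subst (1 2) nodes_decomp) simp
  then show "t = s" by (simp add: nodes_inject)
qed simp

lemma outdeg_restr_Suc [simp]: "outdeg (restr (Suc h) t) [] = outdeg t []"
  by (rule outdeg_restr) auto

lemma subtree_restr_Suc:
  assumes "i \<in> {1..outdeg t []}"
  shows "subtree (restr (Suc h) t) [i] = restr h (subtree t [i])"
proof -
  have "[i] \<in> nodes t" using assms single_in_nodes_iff by simp
  then show ?thesis by (simp add: nodes_subtree nodes_restr flip: nodes_inject)
qed

lemma restr_Suc_eq_iff:
  "restr (Suc h) t = s \<longleftrightarrow> outdeg t [] = outdeg s [] \<and>
     (\<forall>i\<in>{1..outdeg s []}. restr h (subtree t [i]) = subtree s [i])"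
  by (subst otree_eq_iff) (auto simp: subtree_restr_Suc)

lemma level_restr [simp]: "level h (restr h t) = level h t"
  by (auto simp: level_def nodes_restr)

lemma restr_restr [simp]: "restr h (restr h t) = restr h t"
  by (auto simp: nodes_restr simp flip: nodes_inject)

text \<open>Every subtree rooted at a positive height is one of the enumerated subtrees.\<close>

lemma subtree_at_level:
  assumes "u \<in> level b t" "1 \<le> b"
  obtains i where "1 \<le> i" "i \<le> level_size b t" "subtree_above b i t = subtree t u"
proof -
  let ?l = "sorted_list_of_set (level b t)"
  have "u \<in> set ?l" using assms by (simp add: finite_level)
  then obtain j where j: "j < length ?l" "?l ! j = u" by (auto simp: in_set_conv_nth)
  have "length ?l = level_size b t" by (simp add: level_size_def)
  with j show ?thesis by (intro that[of "Suc j"]) (auto simp: subtree_above_def)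
qed

section \<open>Topology and measurability on the space of trees\<close>

lemma open_restr_eq: "open {t. restr h t = s}"
  unfolding open_dist
proof (intro ballI)
  fix t assume t: "t \<in> {t. restr h t = s}"
  have "restr h t' = s" if "dist t' t < (1/2) ^ h" for t'
  proof -
    have "restr (Suc h) t' = restr (Suc h) t" using that dist_otree_lt_iff by blast
    then have "restr h t' = restr h t" by (rule restr_mono) simp
    with t show ?thesis by simp
  qed
  then show "\<exists>e>0. \<forall>t'. dist t' t < e \<longrightarrow> t' \<in> {t. restr h t = s}"
    by (intro exI[of _ "(1/2) ^ h"]) simp
qed

text \<open>A property that depends only on the tree up to some fixed height defines an open set.\<close>

lemma open_of_restr:
  assumes "\<And>t t'. restr h t = restr h t' \<Longrightarrow> P t \<Longrightarrow> P t'"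
  shows "open {t. P t}"
proof -
  have "{t. P t} = (\<Union>t\<in>{t. P t}. {t'. restr h t' = restr h t})"
    using assms[OF sym] by blast
  moreover have "open \<dots>" using open_restr_eq by (intro open_UN) blast
  ultimately show ?thesis by simp
qed

lemma restr_eq_sets [measurable]: "{t. restr h t = s} \<in> sets borel"
  using open_restr_eq by (rule borel_open)

lemma nodes_sets [measurable]: "{t. u \<in> nodes t} \<in> sets borel"
proof (rule borel_open, rule open_of_restr[of "length u"])
  fix t t' assume "restr (length u) t = restr (length u) t'" "u \<in> nodes t"
  then have "u \<in> nodes (restr (length u) t')" by (metis (lifting) mem_Collect_eq nodes_restr order_refl)
  then show "u \<in> nodes t'" by (simp add: nodes_restr)
qed

lemma outdeg_root_sets [measurable]: "{t. outdeg t [] = k} \<in> sets borel"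
proof (rule borel_open, rule open_of_restr[of 1])
  fix t t' assume "restr 1 t = restr 1 t'" "outdeg t [] = k"
  then show "outdeg t' [] = k" by (metis One_nat_def outdeg_restr_Suc)
qed

lemma measurable_subtree [measurable]: "(\<lambda>t. subtree t u) \<in> borel_measurable borel"
proof (rule borel_measurable_otreeI)
  fix v
  \<comment> \<open>If \<open>u\<close> is not a node of \<open>t\<close>, then \<open>subtree t u\<close> is the default value \<open>Tree {}\<close>.\<close>
  have "{t. v \<in> nodes (subtree t u)} = {t. u \<in> nodes t \<and> u @ v \<in> nodes t}
      \<union> {t. u \<notin> nodes t \<and> v \<in> nodes (Tree {})}"
  proof -
    have "{v. u @ v \<in> nodes t} = {}" if "u \<notin> nodes t" for t using that nodes_prefix by blast
    then have sub: "subtree t u = Tree {}" if "u \<notin> nodes t" for t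
      using that by (simp add: subtree_def)
    show ?thesis
    proof (intro set_eqI)
      fix t show "t \<in> {t. v \<in> nodes (subtree t u)} \<longleftrightarrow>
          t \<in> {t. u \<in> nodes t \<and> u @ v \<in> nodes t} \<union> {t. u \<notin> nodes t \<and> v \<in> nodes (Tree {})}"
        by (cases "u \<in> nodes t") (simp_all add: nodes_subtree sub)
    qed
  qed
  also have "\<dots> \<in> sets borel"
  proof (rule sets.Un)
    show "{t. u \<in> nodes t \<and> u @ v \<in> nodes t} \<in> sets borel"
      using sets.Int[OF nodes_sets[of u] nodes_sets[of "u @ v"]] by (simp add: Collect_conj_eq)
    show "{t. u \<notin> nodes t \<and> v \<in> nodes (Tree {})} \<in> sets borel"
      using borel_comp[OF nodes_sets[of u]]
      by (cases "v \<in> nodes (Tree {})") (auto simp: Collect_neg_eq)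
  qed
  finally show "{t \<in> space borel. v \<in> nodes (subtree t u)} \<in> sets borel" by simp
qed

lemma countable_finite_trees: "countable {t. finite_tree t}"
proof -
  have "countable (nodes ` {t. finite_tree t})"
    by (rule countable_subset[OF _ countable_Collect_finite]) (auto simp: finite_tree_def)
  then show ?thesis by (rule countable_image_inj_on) (simp add: inj_on_def nodes_inject)
qed

lemma finite_trees_sets [measurable]: "X \<subseteq> {t. finite_tree t} \<Longrightarrow> X \<in> sets borel"
proof -
  assume "X \<subseteq> {t. finite_tree t}"
  then have "countable X" using countable_finite_trees countable_subset by blast
  then have "(\<Union>t\<in>X. {t}) \<in> sets borel" by (intro sets.countable_UN'') auto
  then show ?thesis by simp
qed

lemma finite_restr: "finite_tree (restr h t)"
proof -
  have "nodes (restr h t) = (\<Union>b\<le>h. level b t)" by (auto simp: nodes_restr level_def)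
  then show ?thesis by (simp add: finite_tree_def finite_level)
qed

lemma countable_range_restr: "countable (range (restr h))"
  by (rule countable_subset[OF _ countable_finite_trees]) (auto simp: finite_restr)

section \<open>The branching property and cylinder probabilities\<close>

text \<open>
  Laws on trees under which the root has offspring distribution \<open>p\<close> and, given its out-degree, the
  subtrees at its children are independent copies of the whole tree. The two requirements are
  merged into one formula for rectangular events, which involves no conditioning and is also
  meaningful for out-degrees of probability \<open>0\<close>.
\<close>

locale branching_law = prob_space Q for Q :: "otree measure" +
  fixes p :: "nat pmf"
  assumes sets_eq [measurable_cong, simp]: "sets Q = sets borel"
    and branching: "\<And>k F. (\<And>i. i \<in> {1..k} \<Longrightarrow> F i \<in> sets borel) \<Longrightarrow>
      prob {t. outdeg t [] = k \<and> (\<forall>i\<in>{1..k}. subtree t [i] \<in> F i)} = pmf p k * (\<Prod>i=1..k. prob (F i))"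
begin

lemma space_eq [simp]: "space Q = UNIV"
  using sets_eq_imp_space_eq[OF sets_eq] by simp

end

lemma galton_watson_branching_law:
  assumes "galton_watson_tree p M \<tau>"
  shows "branching_law (distr M borel \<tau>) p"
proof -
  have meas [measurable]: "\<tau> \<in> borel_measurable M" and ps: "prob_space M"
    and root: "measure M {\<omega> \<in> space M. outdeg (\<tau> \<omega>) [] = k} = pmf p k" for k
    using assms by (auto simp: galton_watson_tree_def)
  interpret M: prob_space M by fact
  interpret Q: prob_space "distr M borel \<tau>" by (rule M.prob_space_distr) simp
  show ?thesis
  proof (unfold_locales, goal_cases)
    case 1 show ?case by simp
  next
    case (2 k F)
    let ?D = "{\<omega> \<in> space M. outdeg (\<tau> \<omega>) [] = k}"
    let ?X = "\<lambda>i \<omega>. subtree_above 1 i (\<tau> \<omega>)"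
    let ?C = "uniform_measure M ?D"
    let ?E = "{t. outdeg t [] = k \<and> (\<forall>i\<in>{1..k}. subtree t [i] \<in> F i)}"
    have D: "?D \<in> sets M"
      using measurable_sets[OF meas outdeg_root_sets[of k]]
      by (simp add: vimage_def Int_def conj_commute)
    have E: "?E \<in> sets borel"
    proof -
      have "(\<lambda>t. subtree t [i]) -` F i \<in> sets borel" if "i \<in> {1..k}" for i
        using measurable_sets[OF measurable_subtree 2[OF that], of "[i]"] by simp
      then have "{t. outdeg t [] = k} \<inter> (\<Inter>i\<in>{1..k}. (\<lambda>t. subtree t [i]) -` F i) \<in> sets borel"
        if "k \<ge> 1" using that by (intro sets.Int outdeg_root_sets sets.finite_INT) auto
      moreover have "?E = {t. outdeg t [] = k} \<inter> (\<Inter>i\<in>{1..k}. (\<lambda>t. subtree t [i]) -` F i)"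
        by auto
      ultimately show ?thesis using outdeg_root_sets[of k] by (cases "k = 0") auto
    qed
    have pre: "\<tau> -` ?E \<inter> space M = ?D \<inter> {\<omega> \<in> space M. \<forall>i\<in>{1..k}. ?X i \<omega> \<in> F i}"
      using subtree_above_1 by auto
    have eq: "measure (distr M borel \<tau>) ?E
        = measure M (?D \<inter> {\<omega> \<in> space M. \<forall>i\<in>{1..k}. ?X i \<omega> \<in> F i})"
      using E by (simp only: measure_distr[OF meas] pre)
    show ?case
    proof (cases "k = 0 \<or> pmf p k = 0")
      case True
      then show ?thesis
      proof
        assume "k = 0"
        moreover have "?D \<inter> {\<omega> \<in> space M. \<forall>i\<in>{1..0::nat}. ?X i \<omega> \<in> F i} = ?D" by auto
        ultimately show ?thesis using eq root[of k] by simp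
      next
        assume "pmf p k = 0"
        moreover have "measure M (?D \<inter> {\<omega> \<in> space M. \<forall>i\<in>{1..k}. ?X i \<omega> \<in> F i}) \<le> measure M ?D"
          by (rule M.finite_measure_mono[OF _ D]) blast
        ultimately show ?thesis using eq root[of k] by (simp add: measure_le_0_iff)
      qed
    next
      case False
      then have k: "k \<ge> 1" "pmf p k > 0" by (auto simp: pmf_pos)
      have D0: "emeasure M ?D \<noteq> 0" using root[of k] k by (simp add: M.emeasure_eq_measure)
      interpret C: prob_space ?C using D0 by (intro prob_space_uniform_measure) auto
      have ind: "C.indep_vars (\<lambda>_. borel) ?X {1..k}"
        and law: "\<And>i. i \<in> {1..k} \<Longrightarrow> distr ?C borel (?X i) = distr M borel \<tau>"
        using assms k by (auto simp: galton_watson_tree_def Let_def)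
      have rv: "?X i \<in> borel_measurable ?C" if "i \<in> {1..k}" for i
        using ind that by (auto simp: C.indep_vars_def)
      have sp: "space ?C = space M" by simp
      let ?I = "\<Inter>i\<in>{1..k}. ?X i -` F i \<inter> space ?C"
      have I: "?I \<in> sets ?C" using k 2 rv by (intro sets.finite_INT measurable_sets) auto
      have "?D \<inter> {\<omega> \<in> space M. \<forall>i\<in>{1..k}. ?X i \<omega> \<in> F i} = ?D \<inter> ?I" using k by auto
      then have "measure (distr M borel \<tau>) ?E = measure M (?D \<inter> ?I)" using eq by simp
      also have "\<dots> = measure M ?D * measure ?C ?I"
        using D0 I k root[of k] by (subst measure_uniform_measure) auto
      also have "measure ?C ?I = (\<Prod>i=1..k. measure ?C (?X i -` F i \<inter> space ?C))"
        using k 2 by (intro C.indep_varsD_finite[OF ind]) auto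
      also have "\<dots> = (\<Prod>i=1..k. measure (distr M borel \<tau>) (F i))"
      proof (rule prod.cong)
        fix i assume i: "i \<in> {1..k}"
        show "measure ?C (?X i -` F i \<inter> space ?C) = measure (distr M borel \<tau>) (F i)"
          using measure_distr[OF rv[OF i] 2[OF i]] law[OF i] by simp
      qed simp
      finally show ?thesis using root[of k] by simp
    qed
  qed
qed

text \<open>
  The weight of the nodes of \<open>t\<close> below height \<open>h\<close>, that is, the probability that a Galton-Watson
  tree agrees with \<open>t\<close> up to height \<open>h\<close>. Nodes at height \<open>h\<close> do not contribute.
\<close>

definition weight :: "nat pmf \<Rightarrow> nat \<Rightarrow> otree \<Rightarrow> real" where
  "weight p h t = (\<Prod>v\<in>{v \<in> nodes t. length v < h}. pmf p (outdeg t v))"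

lemma finite_nodes_below: "finite {v \<in> nodes t. length v < h}"
proof -
  have "{v \<in> nodes t. length v < h} = (\<Union>b<h. level b t)" by (auto simp: level_def)
  then show ?thesis by (simp add: finite_level)
qed

lemma weight_0 [simp]: "weight p 0 t = 1"
  by (simp add: weight_def)

lemma weight_Suc:
  "weight p (Suc h) t = pmf p (outdeg t []) * (\<Prod>i=1..outdeg t []. weight p h (subtree t [i]))"
proof -
  let ?N = "\<lambda>i. {v \<in> nodes (subtree t [i]). length v < h}"
  let ?k = "outdeg t []"
  have eq: "{v \<in> nodes t. length v < Suc h} = insert [] (\<Union>i\<in>{1..?k}. Cons i ` ?N i)"
    by (subst nodes_decomp) auto
  have fin: "finite (\<Union>i\<in>{1..?k}. Cons i ` ?N i)" by (simp add: finite_nodes_below)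
  have "weight p (Suc h) t = pmf p ?k * (\<Prod>v\<in>(\<Union>i\<in>{1..?k}. Cons i ` ?N i). pmf p (outdeg t v))"
    unfolding weight_def eq using fin by (subst prod.insert) auto
  also have "(\<Prod>v\<in>(\<Union>i\<in>{1..?k}. Cons i ` ?N i). pmf p (outdeg t v))
      = (\<Prod>i=1..?k. \<Prod>v\<in>Cons i ` ?N i. pmf p (outdeg t v))"
    by (rule prod.UNION_disjoint) (auto simp: finite_nodes_below)
  also have "\<dots> = (\<Prod>i=1..?k. weight p h (subtree t [i]))"
  proof (rule prod.cong[OF refl])
    fix i assume i: "i \<in> {1..?k}"
    have od: "outdeg t (i # v) = outdeg (subtree t [i]) v" if "v \<in> ?N i" for v
    proof -
      have "[i] @ v \<in> nodes t" using i that by (simp add: Cons_in_nodes_iff)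
      from outdeg_subtree[OF this] show ?thesis by simp
    qed
    have "(\<Prod>v\<in>Cons i ` ?N i. pmf p (outdeg t v)) = (\<Prod>v\<in>?N i. pmf p (outdeg t (i # v)))"
      by (subst prod.reindex) simp_all
    then show "(\<Prod>v\<in>Cons i ` ?N i. pmf p (outdeg t v)) = weight p h (subtree t [i])"
      using od by (simp add: weight_def)
  qed
  finally show ?thesis .
qed

text \<open>
  The trees that arise from \<open>s\<close> by attaching a tree from \<open>G\<close> to each node at height \<open>h\<close>; the set is
  empty if \<open>s\<close> has nodes above height \<open>h\<close>.
\<close>

definition grafted :: "nat \<Rightarrow> otree \<Rightarrow> otree set \<Rightarrow> otree set" where
  "grafted h s G = {t. restr h t = s \<and> (\<forall>u\<in>level h t. subtree t u \<in> G)}"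

lemma grafted_Suc:
  "grafted (Suc h) s G = {t. outdeg t [] = outdeg s [] \<and>
     (\<forall>i\<in>{1..outdeg s []}. subtree t [i] \<in> grafted h (subtree s [i]) G)}"
proof -
  have "(\<forall>u\<in>level (Suc h) t. subtree t u \<in> G) \<longleftrightarrow>
      (\<forall>i\<in>{1..outdeg t []}. \<forall>u\<in>level h (subtree t [i]). subtree (subtree t [i]) u \<in> G)" for t
  proof -
    have "subtree t (i # u) = subtree (subtree t [i]) u"
      if "i \<in> {1..outdeg t []}" "u \<in> level h (subtree t [i])" for i u
      using subtree_subtree[of "[i]" u t] that by (simp add: level_def Cons_in_nodes_iff)
    then show ?thesis by (auto simp: level_Suc)
  qed
  then show ?thesis by (auto simp: grafted_def restr_Suc_eq_iff)
qed

lemma grafted_sets: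
  assumes "G \<in> sets borel"
  shows "grafted h s G \<in> sets borel"
proof -
  have "grafted h s G = {t. restr h t = s} \<inter> (\<Inter>u\<in>level h s. (\<lambda>t. subtree t u) -` G)"
    by (auto simp: grafted_def)
  moreover have "(\<lambda>t. subtree t u) -` G \<in> sets borel" for u
    using measurable_sets[OF measurable_subtree assms, of u] by simp
  ultimately show ?thesis
    using finite_level[of h s] by (cases "level h s = {}") (auto intro!: sets.Int sets.finite_INT)
qed

text \<open>With \<open>G\<close> the set of all trees, this gives the cylinder probabilities of a branching law.\<close>

lemma (in branching_law) prob_grafted:
  assumes "G \<in> sets borel" "restr h s = s"
  shows "prob (grafted h s G) = weight p h s * prob G ^ level_size h s"
  using assms(2)
proof (induction h arbitrary: s)
  case 0
  have "level 0 t = {[]}" for t by (auto simp: level_def)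
  moreover have "restr 0 t = s" for t using 0 restr_0 by metis
  ultimately show ?case by (simp add: grafted_def level_size_def)
next
  case (Suc h)
  let ?k = "outdeg s []"
  have sub: "restr h (subtree s [i]) = subtree s [i]" if "i \<in> {1..?k}" for i
    using Suc.prems that restr_Suc_eq_iff by blast
  have "prob (grafted (Suc h) s G) = pmf p ?k * (\<Prod>i=1..?k. prob (grafted h (subtree s [i]) G))"
    unfolding grafted_Suc using assms(1) by (intro branching grafted_sets)
  also have "(\<Prod>i=1..?k. prob (grafted h (subtree s [i]) G))
      = (\<Prod>i=1..?k. weight p h (subtree s [i])) * prob G ^ (\<Sum>i=1..?k. level_size h (subtree s [i]))"
    using Suc.IH[OF sub] by (simp add: prod.distrib power_sum)
  finally show ?case by (simp add: weight_Suc level_size_Suc)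
qed

section \<open>Almost sure extinction in the critical case\<close>

lemma sums_mean:
  assumes "offspring_mean p = 1"
  shows "(\<lambda>k. real k * pmf p k) sums 1"
proof -
  have int: "integrable (measure_pmf p) real"
    using assms not_integrable_integral_eq unfolding offspring_mean_def by fastforce
  then have "integrable (count_space UNIV) (\<lambda>k. pmf p k *\<^sub>R real k)"
    by (simp add: measure_pmf_eq_density integrable_density)
  from sums_integral_count_space_nat[OF this]
  have "(\<lambda>k. pmf p k *\<^sub>R real k) sums (\<integral>k. pmf p k *\<^sub>R real k \<partial>count_space UNIV)" .
  also have "(\<integral>k. pmf p k *\<^sub>R real k \<partial>count_space UNIV) = offspring_mean p"
    unfolding offspring_mean_def by (simp add: measure_pmf_eq_density integral_density)
  finally show ?thesis using assms by (simp add: mult.commute)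
qed

lemma sums_pmf: "pmf (p :: nat pmf) sums 1"
proof -
  have "(\<lambda>k. measure (measure_pmf p) {k}) sums measure (measure_pmf p) (\<Union>k. {k})"
    by (rule measure_pmf.finite_measure_UNION) (auto simp: disjoint_family_on_def)
  then show ?thesis by (simp add: pmf.rep_eq measure_pmf.prob_space[simplified])
qed

lemma (in branching_law) sums_prob_finite:
  "(\<lambda>k. pmf p k * prob {t. finite_tree t} ^ k) sums prob {t. finite_tree t}"
proof -
  let ?f = "prob {t. finite_tree t}"
  let ?E = "\<lambda>k. {t. outdeg t [] = k \<and> (\<forall>i\<in>{1..k}. subtree t [i] \<in> {t. finite_tree t})}"
  have E: "?E k = {t. outdeg t [] = k \<and> finite_tree t}" for k
    by (subst finite_tree_iff) auto
  have "(\<lambda>k. prob (?E k)) sums prob (\<Union>k. ?E k)"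
    unfolding E
    by (rule finite_measure_UNION) (auto simp: disjoint_family_on_def intro!: finite_trees_sets)
  moreover have "(\<Union>k. ?E k) = {t. finite_tree t}" unfolding E by blast
  moreover have "prob (?E k) = pmf p k * ?f ^ k" for k
    using branching[of k "\<lambda>_. {t. finite_tree t}"] by (simp add: finite_trees_sets)
  ultimately show ?thesis by simp
qed

text \<open>
  A fixed point \<open>0 < f < 1\<close> of the generating function would give equality in Bernoulli's inequality
  \<open>f ^ k \<ge> 1 - k * (1 - f)\<close> for every \<open>k\<close> charged by \<open>p\<close>, since by criticality both sides have the
  same mean. The inequality is strict for \<open>k \<ge> 2\<close>, so \<open>p\<close> would live on \<open>{0, 1}\<close>.
\<close>

lemma (in branching_law) extinction:
  assumes "offspring_mean p = 1" "pmf p 1 \<noteq> 1" "prob {t. finite_tree t} > 0"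
  shows "prob {t. finite_tree t} = 1"
proof (rule ccontr)
  let ?f = "prob {t. finite_tree t}"
  assume "?f \<noteq> 1"
  then have "?f < 1" using prob_le_1[of "{t. finite_tree t}"] by linarith
  with assms(3) have f: "0 < ?f" "?f < 1" by blast+
  \<comment> \<open>the Bernoulli defect, weighted by \<open>p\<close>\<close>
  define g where "g k = pmf p k * (?f ^ k - (1 - real k * (1 - ?f)))" for k
  have bern: "1 - real k * (1 - ?f) \<le> ?f ^ k" for k
    using Bernoulli_inequality[of "?f - 1" k] f by (simp add: algebra_simps)
  have g0: "g k \<ge> 0" for k unfolding g_def using bern[of k] by simp
  have "(\<lambda>k. pmf p k * ?f ^ k - (pmf p k - (1 - ?f) * (real k * pmf p k)))
      sums (?f - (1 - (1 - ?f) * 1))"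
    using assms(1) by (intro sums_diff sums_mult sums_prob_finite sums_pmf sums_mean)
  then have g: "g sums 0" unfolding g_def by (simp add: algebra_simps)
  then have "suminf g = 0" "summable g" by (simp_all add: sums_iff)
  with g0 have gk: "g k = 0" for k using suminf_eq_zero_iff by blast
  have zero: "pmf p k = 0" if k: "k \<ge> 2" for k
  proof -
    obtain m where m: "k = Suc m" "m \<ge> 1" using k by (cases k) auto
    have "1 - real k * (1 - ?f) < ?f * (1 - real m * (1 - ?f))"
    proof -
      have "?f * (1 - real m * (1 - ?f)) - (1 - real k * (1 - ?f)) = real m * (1 - ?f)\<^sup>2"
        unfolding m by (simp add: algebra_simps power2_eq_square)
      moreover have "real m * (1 - ?f)\<^sup>2 > 0" using f m by simp
      ultimately show ?thesis by linarith
    qed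
    also have "\<dots> \<le> ?f ^ k" unfolding m using bern[of m] f by simp
    finally show ?thesis using gk[of k] by (simp add: g_def)
  qed
  have "(\<lambda>k. real k * pmf p k) = (\<lambda>k. if k = 1 then pmf p 1 else 0)"
  proof
    fix k :: nat
    consider "k = 0" | "k = 1" | "k \<ge> 2" by linarith
    then show "real k * pmf p k = (if k = 1 then pmf p 1 else 0)" by cases (auto simp: zero)
  qed
  then have "(\<lambda>k. real k * pmf p k) sums pmf p 1" using sums_single[of 1 "\<lambda>_. pmf p 1"] by simp
  with sums_mean[OF assms(1)] assms(2) show False using sums_unique2 by blast
qed

section \<open>Cylinder probabilities of the immortal tree\<close>

lemma node_law_normal: "measure (node_law p) {x. fst x = k} = pmf p k"
proof -
  have "measure (node_law p) {x. fst x = k} = measure (map_pmf fst (node_law p)) {k}"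
    by (simp add: vimage_def)
  also have "map_pmf fst (node_law p) = p" by (simp add: node_law_def map_fst_pair_pmf)
  finally show ?thesis by (simp add: pmf.rep_eq)
qed

text \<open>The size-biased weight \<open>k * pmf p k\<close> is cancelled by the uniform choice of the special child.\<close>

lemma node_law_special:
  assumes "offspring_mean p = 1"
  shows "measure (node_law p) {x. snd x = (k, j)} \<le> pmf p k"
proof -
  let ?B = "bind_pmf (size_biased p) (\<lambda>k'. map_pmf (\<lambda>j. (k', j)) (pmf_of_set {1..k'}))"
  have "measure (node_law p) {x. snd x = (k, j)} = measure (map_pmf snd (node_law p)) {(k, j)}"
    by (simp add: vimage_def)
  also have "map_pmf snd (node_law p) = ?B" by (simp add: node_law_def map_snd_pair_pmf)
  also have "measure ?B {(k, j)} = pmf ?B (k, j)" by (simp add: pmf.rep_eq)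
  also have "\<dots> = (\<integral>k'. pmf (map_pmf (\<lambda>j. (k', j)) (pmf_of_set {1..k'})) (k, j) \<partial>size_biased p)"
    by (rule pmf_bind)
  also have "\<dots> = (\<integral>k'. indicator {k} k' * pmf (pmf_of_set {1..k}) j \<partial>size_biased p)"
  proof (rule Bochner_Integration.integral_cong[OF refl])
    fix k'
    show "pmf (map_pmf (\<lambda>j. (k', j)) (pmf_of_set {1..k'})) (k, j)
        = indicator {k} k' * pmf (pmf_of_set {1..k}) j"
    proof (cases "k' = k")
      case True
      then show ?thesis
        using pmf_map_inj'[of "Pair k" "pmf_of_set {1..k}" j] by (simp add: inj_on_def)
    next
      case False
      then have "(k, j) \<notin> Pair k' ` set_pmf (pmf_of_set {1..k'})" by auto
      then show ?thesis using False by (simp add: pmf_map_outside)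
    qed
  qed
  also have "\<dots> = pmf (size_biased p) k * pmf (pmf_of_set {1..k}) j"
    by (simp add: pmf.rep_eq)
  also have "\<dots> \<le> pmf p k"
  proof (cases "k = 0")
    case False
    then have "pmf (pmf_of_set {1..k}) j \<le> 1 / real k" by (simp add: indicator_def)
    then have "pmf p k * (real k * pmf (pmf_of_set {1..k}) j) \<le> pmf p k * 1"
      using False by (intro mult_left_mono) (auto simp: field_simps)
    then show ?thesis using assms by (simp add: pmf_size_biased mult_ac)
  qed (use assms in \<open>simp add: pmf_size_biased\<close>)
  finally show ?thesis .
qed

lemma AE_node_law:
  assumes "offspring_mean p = 1"
  shows "AE x in node_law p. snd (snd x) \<in> {1..fst (snd x)}"
proof -
  have "snd (snd x) \<in> {1..fst (snd x)}" if x: "x \<in> set_pmf (node_law p)" for x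
  proof -
    obtain a k j where [simp]: "x = (a, k, j)" by (cases x)
    have k: "k \<in> set_pmf (size_biased p)" and j: "j \<in> set_pmf (pmf_of_set {1..k})"
      using x by (auto simp: node_law_def)
    have "k \<noteq> 0" using k assms by (auto simp: set_pmf_iff pmf_size_biased)
    then show ?thesis using j by (subst (asm) set_pmf_of_set) auto
  qed
  then show ?thesis by (simp add: AE_measure_pmf_iff)
qed

text \<open>
  The sequence of special nodes, followed from the root through the indices of the special children.
  It is defined for every \<open>\<omega>\<close>, but it runs through nodes of the immortal tree only if all these
  indices are admissible.
\<close>

fun spine :: "(nat list \<Rightarrow> nat \<times> nat \<times> nat) \<Rightarrow> nat \<Rightarrow> nat list" where
  "spine \<omega> 0 = []"
| "spine \<omega> (Suc n) = spine \<omega> n @ [snd (snd (\<omega> (spine \<omega> n)))]"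

lemma length_spine [simp]: "length (spine \<omega> n) = n"
  by (induction n) auto

lemma take_spine: "m \<le> n \<Longrightarrow> take m (spine \<omega> n) = spine \<omega> m"
  by (induction n) (auto simp: le_Suc_eq)

lemma special_iff_spine: "special \<omega> u \<longleftrightarrow> u = spine \<omega> (length u)"
proof (induction u rule: rev_induct)
  case Nil
  show ?case by (simp add: special_def)
next
  case (snoc i u)
  have "special \<omega> (u @ [i]) \<longleftrightarrow> special \<omega> u \<and> i = snd (snd (\<omega> u))"
    by (auto simp: special_def nth_append less_Suc_eq)
  also have "\<dots> \<longleftrightarrow> u @ [i] = spine \<omega> (length (u @ [i]))" using snoc.IH by auto
  finally show ?case .
qed

lemma nth_spine: "l < n \<Longrightarrow> spine \<omega> n ! l = snd (snd (\<omega> (spine \<omega> l)))"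
  using special_iff_spine[of \<omega> "spine \<omega> n"] by (simp add: special_def take_spine)

lemma outdeg_immortal_tree:
  assumes "u \<in> nodes (immortal_tree \<omega>)"
  shows "outdeg (immortal_tree \<omega>) u = offspring \<omega> u"
  using assms
  by (intro outdeg_unique) (auto simp: nodes_immortal_tree nth_append less_Suc_eq)

lemma spine_in_nodes:
  assumes "\<And>u. snd (snd (\<omega> u)) \<in> {1..fst (snd (\<omega> u))}"
  shows "spine \<omega> n \<in> nodes (immortal_tree \<omega>)"
  using assms
  by (auto simp: nodes_immortal_tree nth_spine take_spine offspring_def special_iff_spine)

text \<open>
  For \<open>s\<close> of height at most \<open>h\<close> equality holds, but the union bound over
  the position \<open>u\<close> of the special node at height \<open>h\<close> yields the inequality without any disjointness
  argument, and only the inequality is needed.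
\<close>

lemma immortal_cylinder_le:
  assumes "offspring_mean p = 1"
  shows "measure (immortal_tree_law p) {t. restr h t = s} \<le> real (level_size h s) * weight p h s"
proof -
  let ?P = "\<Pi>\<^sub>M u\<in>UNIV::nat list set. measure_pmf (node_law p)"
  interpret P: product_prob_space "\<lambda>_::nat list. measure_pmf (node_law p)" UNIV
    by unfold_locales
  let ?J = "{v \<in> nodes s. length v < h}"
  \<comment> \<open>\<open>E u\<close> prescribes the data of the nodes below height \<open>h\<close> when \<open>u\<close> is the special node at
    height \<open>h\<close>: the nodes on the path to \<open>u\<close> are special, the others are normal.\<close>
  define X where "X u v = (if take (length v) u = v
      then {x. snd x = (outdeg s v, u ! length v)} else {x. fst x = outdeg s v})"
    for u v :: "nat list"
  define E where "E u = prod_emb UNIV (\<lambda>_. measure_pmf (node_law p)) ?J (\<Pi>\<^sub>E v\<in>?J. X u v)" for u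
  have E_sets: "E u \<in> sets ?P" for u
    unfolding E_def by (intro sets_PiM_I) (auto simp: finite_nodes_below)
  have memE: "\<omega> \<in> E u \<longleftrightarrow> (\<forall>v\<in>?J. \<omega> v \<in> X u v)" for \<omega> u
    by (auto simp: E_def prod_emb_def PiE_iff)
  have prob_E: "measure ?P (E u) \<le> weight p h s" for u
  proof -
    have "measure ?P (E u) = (\<Prod>v\<in>?J. measure (node_law p) (X u v))"
      unfolding E_def by (rule P.measure_PiM_emb) (auto simp: finite_nodes_below)
    also have "\<dots> \<le> weight p h s" unfolding weight_def
      using assms by (intro prod_mono) (auto simp: X_def node_law_normal node_law_special)
    finally show ?thesis .
  qed
  have "AE \<omega> in ?P. \<forall>u. snd (snd (\<omega> u)) \<in> {1..fst (snd (\<omega> u))}"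
    unfolding AE_all_countable
    by (intro allI AE_PiM_component[where P = "\<lambda>x. snd (snd x) \<in> {1..fst (snd x)}"] AE_node_law assms)
       (auto intro: measure_pmf.prob_space_axioms)
  then have incl: "AE \<omega> in ?P. \<omega> \<in> immortal_tree -` {t. restr h t = s} \<inter> space ?P
      \<longrightarrow> \<omega> \<in> (\<Union>u\<in>level h s. E u)"
  proof (rule AE_mp, intro AE_I2 impI)
    fix \<omega> assume good: "\<forall>u. snd (snd (\<omega> u)) \<in> {1..fst (snd (\<omega> u))}"
      and "\<omega> \<in> immortal_tree -` {t. restr h t = s} \<inter> space ?P"
    then have s: "s = restr h (immortal_tree \<omega>)" by simp
    let ?u = "spine \<omega> h"
    have "?u \<in> level h s" unfolding s level_restr
      using spine_in_nodes good by (simp add: level_def)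
    moreover have "\<omega> v \<in> X ?u v" if v: "v \<in> ?J" for v
    proof -
      have vt: "v \<in> nodes (immortal_tree \<omega>)" "length v < h" using v by (auto simp: s nodes_restr)
      have deg: "outdeg s v = offspring \<omega> v"
        unfolding s using vt by (simp add: outdeg_restr outdeg_immortal_tree)
      show ?thesis
      proof (cases "special \<omega> v")
        case True
        then have sv: "v = spine \<omega> (length v)" by (simp add: special_iff_spine)
        have "?u ! length v = snd (snd (\<omega> v))" using nth_spine[OF vt(2)] sv by metis
        moreover have "take (length v) ?u = v" using take_spine vt(2) sv by (metis less_imp_le)
        ultimately show ?thesis using True deg by (simp add: X_def offspring_def prod_eq_iff)
      next
        case False
        then have "take (length v) ?u \<noteq> v"
          using take_spine[of "length v" h \<omega>] vt(2) by (auto simp: special_iff_spine)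
        then show ?thesis using False deg by (simp add: X_def offspring_def)
      qed
    qed
    ultimately show "\<omega> \<in> (\<Union>u\<in>level h s. E u)" using memE by blast
  qed
  have "measure (immortal_tree_law p) {t. restr h t = s}
      = measure ?P (immortal_tree -` {t. restr h t = s} \<inter> space ?P)"
    unfolding immortal_tree_law_def by (intro measure_distr measurable_immortal_tree restr_eq_sets)
  also have "\<dots> \<le> measure ?P (\<Union>u\<in>level h s. E u)"
    using incl E_sets by (intro P.finite_measure_mono_AE sets.finite_UN finite_level)
  also have "\<dots> \<le> (\<Sum>u\<in>level h s. measure ?P (E u))"
    using E_sets by (intro P.finite_measure_subadditive_finite finite_level) auto
  also have "\<dots> \<le> real (card (level h s)) * weight p h s"
    using prob_E by (intro sum_bounded_above)
  finally show ?thesis by (simp add: level_size_def)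
qed

section \<open>Weak convergence from lower bounds on cylinders\<close>

text \<open>
  For nonnegative continuous integrands, a lower bound on the limes inferior of the cylinder
  probabilities passes to integrals. The integrand \<open>f\<close> is approximated from below by its infima over cylinders of increasing height, which exhaust
  \<open>f\<close> by continuity; at a fixed height the integral is a countable sum over cylinders, to which
  Fatou's lemma applies.
\<close>

lemma nn_integral_otree_le_liminf:
  fixes f :: "otree \<Rightarrow> ennreal"
  assumes cont: "continuous_on UNIV f"
    and P: "\<And>n. sets (P n) = sets borel" and Q: "sets Q = sets borel"
    and cyl: "\<And>h s. emeasure Q {t. restr h t = s} \<le> liminf (\<lambda>n. emeasure (P n) {t. restr h t = s})"
  shows "(\<integral>\<^sup>+t. f t \<partial>Q) \<le> liminf (\<lambda>n. \<integral>\<^sup>+t. f t \<partial>P n)"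
proof -
  define g where "g h s = (INF t\<in>{t. restr h t = s}. f t)" for h :: nat and s
  have g_le: "g h (restr h t) \<le> f t" for h t unfolding g_def by (rule INF_lower) simp
  have int_g: "(\<integral>\<^sup>+t. g h (restr h t) \<partial>R)
      = (\<integral>\<^sup>+s. g h s * emeasure R {t. restr h t = s} \<partial>count_space (range (restr h)))"
    if R: "sets R = sets borel" for h and R :: "otree measure"
  proof -
    have [measurable]: "{t. restr h t = s} \<in> sets R" for s using R by simp
    have "g h (restr h t) = (\<integral>\<^sup>+s. g h s * indicator {t. restr h t = s} t \<partial>count_space (range (restr h)))"
      for t
    proof -
      have "(\<integral>\<^sup>+s. g h s * indicator {t. restr h t = s} t \<partial>count_space (range (restr h)))
          = (\<integral>\<^sup>+s. g h (restr h t) * indicator {restr h t} s \<partial>count_space (range (restr h)))"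
        by (intro nn_integral_cong) (auto simp: indicator_def)
      then show ?thesis by (simp add: nn_integral_cmult_indicator)
    qed
    then have "(\<integral>\<^sup>+t. g h (restr h t) \<partial>R)
        = (\<integral>\<^sup>+t. \<integral>\<^sup>+s. g h s * indicator {t. restr h t = s} t \<partial>count_space (range (restr h)) \<partial>R)"
      by simp
    also have "\<dots> = (\<integral>\<^sup>+s. \<integral>\<^sup>+t. g h s * indicator {t. restr h t = s} t \<partial>R \<partial>count_space (range (restr h)))"
      by (rule nn_integral_count_space_nn_integral[OF countable_range_restr]) measurable
    also have "\<dots> = (\<integral>\<^sup>+s. g h s * emeasure R {t. restr h t = s} \<partial>count_space (range (restr h)))"
      by (simp add: nn_integral_cmult_indicator)
    finally show ?thesis .
  qed
  have step: "(\<integral>\<^sup>+t. g h (restr h t) \<partial>Q) \<le> liminf (\<lambda>n. \<integral>\<^sup>+t. f t \<partial>P n)" for h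
  proof -
    let ?C = "\<lambda>s. {t. restr h t = s}"
    have "(\<integral>\<^sup>+t. g h (restr h t) \<partial>Q)
        \<le> (\<integral>\<^sup>+s. liminf (\<lambda>n. g h s * emeasure (P n) (?C s)) \<partial>count_space (range (restr h)))"
      unfolding int_g[OF Q]
    proof (rule nn_integral_mono)
      fix s
      have "g h s * emeasure Q (?C s) \<le> g h s * liminf (\<lambda>n. emeasure (P n) (?C s))"
        by (intro mult_left_mono cyl) simp
      also have "\<dots> \<le> liminf (\<lambda>n. g h s * emeasure (P n) (?C s))"
        unfolding liminf_SUP_INF SUP_mult_left_ennreal
        by (intro SUP_mono' INF_greatest mult_left_mono INF_lower) auto
      finally show "g h s * emeasure Q (?C s) \<le> liminf (\<lambda>n. g h s * emeasure (P n) (?C s))" .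
    qed
    also have "\<dots> \<le> liminf (\<lambda>n. \<integral>\<^sup>+s. g h s * emeasure (P n) (?C s) \<partial>count_space (range (restr h)))"
      by (rule nn_integral_liminf) simp
    also have "\<dots> = liminf (\<lambda>n. \<integral>\<^sup>+t. g h (restr h t) \<partial>P n)"
      by (simp add: int_g[OF P])
    also have "\<dots> \<le> liminf (\<lambda>n. \<integral>\<^sup>+t. f t \<partial>P n)"
      by (intro Liminf_mono always_eventually allI nn_integral_mono g_le)
    finally show ?thesis .
  qed
  have "f t \<le> (SUP h. g h (restr h t))" for t
  proof (rule dense_le)
    fix y assume "y < f t"
    moreover have "isCont f t" using cont by (simp add: continuous_on_eq_continuous_at)
    ultimately have "eventually (\<lambda>t'. y < f t') (nhds t)"
      using order_tendstoD(1)[of f "f t" "nhds t" y] by (simp add: isCont_def tendsto_at_iff_tendsto_nhds)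
    then obtain e where e: "e > 0" "\<And>t'. dist t' t < e \<Longrightarrow> y < f t'"
      unfolding eventually_nhds_metric by blast
    obtain h where h: "(1/2::real) ^ h < e" using real_arch_pow_inv[of e "1/2"] e(1) by auto
    have "y \<le> g (Suc h) (restr (Suc h) t)" unfolding g_def
    proof (rule INF_greatest)
      fix t' assume "t' \<in> {t'. restr (Suc h) t' = restr (Suc h) t}"
      then show "y \<le> f t'" using e(2)[of t'] h dist_otree_lt_iff[of t' t h] by simp
    qed
    also have "\<dots> \<le> (SUP h. g h (restr h t))" by (rule SUP_upper) simp
    finally show "y \<le> (SUP h. g h (restr h t))" .
  qed
  then have "(\<integral>\<^sup>+t. f t \<partial>Q) \<le> (\<integral>\<^sup>+t. (SUP h. g h (restr h t)) \<partial>Q)" by (intro nn_integral_mono)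
  also have "\<dots> = (SUP h. \<integral>\<^sup>+t. g h (restr h t) \<partial>Q)"
  proof (rule nn_integral_monotone_convergence_SUP)
    show "incseq (\<lambda>h t. g h (restr h t))"
    proof (intro incseq_SucI le_funI)
      fix h t
      have "{t'. restr (Suc h) t' = restr (Suc h) t} \<subseteq> {t'. restr h t' = restr h t}"
        by (intro Collect_mono impI) (erule restr_mono, simp)
      then show "g h (restr h t) \<le> g (Suc h) (restr (Suc h) t)"
        unfolding g_def by (intro INF_superset_mono) auto
    qed
    show "(\<lambda>t. g h (restr h t)) \<in> borel_measurable Q" for h
    proof -
      have "restr h \<in> measurable Q (count_space (range (restr h)))"
        by (rule measurable_count_space_eq_countable[THEN iffD2, OF countable_range_restr])
           (auto simp: sets_eq_imp_space_eq[OF Q] Q vimage_def)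
      then show ?thesis by (rule measurable_compose) simp
    qed
  qed
  also have "\<dots> \<le> liminf (\<lambda>n. \<integral>\<^sup>+t. f t \<partial>P n)" by (rule SUP_least) (rule step)
  finally show ?thesis .
qed

text \<open>
  The lower bound for integrals is applied to \<open>f + K\<close> and \<open>K - f\<close>, where \<open>K\<close> bounds \<open>\<bar>f\<bar>\<close>. Since all
  measures have total mass \<open>1\<close>, the constant drops out, and the one-sided hypothesis bounds the
  integrals of \<open>f\<close> from both sides.
\<close>

lemma weakly_converges_otreeI:
  assumes P: "\<And>n. prob_space (P n)" "\<And>n. sets (P n) = sets borel"
    and Q: "prob_space Q" "sets Q = sets borel"
    and cyl: "\<And>h s. emeasure Q {t. restr h t = s} \<le> liminf (\<lambda>n. emeasure (P n) {t. restr h t = s})"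
  shows "weakly_converges P Q"
  unfolding weakly_converges_def
proof (intro allI impI)
  have low: "eventually (\<lambda>n. a < (\<integral>t. f t \<partial>P n)) sequentially"
    if f: "continuous_on UNIV f" "bounded (range f)" and a: "a < (\<integral>t. f t \<partial>Q)"
    for f :: "otree \<Rightarrow> real" and a
  proof -
    \<comment> \<open>The shifted function is at least \<open>1\<close>, so its integrals are strictly positive and strict
      inequalities survive the passage to \<open>ennreal\<close>.\<close>
    obtain K where K: "\<And>t. \<bar>f t\<bar> \<le> K - 1"
      using f(2) unfolding bounded_iff by (metis add_diff_cancel_right' rangeI real_norm_def)
    have pos: "1 \<le> f t + K" for t using K[of t] by linarith
    have shift: "(\<integral>\<^sup>+t. ennreal (f t + K) \<partial>R) = ennreal ((\<integral>t. f t \<partial>R) + K)"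
      "0 < (\<integral>t. f t \<partial>R) + K"
      if "prob_space R" and R: "sets R = sets borel" for R :: "otree measure"
    proof -
      interpret prob_space R by fact
      have "f \<in> borel_measurable R"
        using borel_measurable_continuous_onI[OF f(1)] R by (simp cong: measurable_cong_sets)
      then have int: "integrable R f" using K by (intro integrable_const_bound[of _ "K - 1"]) auto
      then have eq: "(\<integral>t. f t + K \<partial>R) = (\<integral>t. f t \<partial>R) + K" by (simp add: prob_space)
      have "(\<integral>\<^sup>+t. ennreal (f t + K) \<partial>R) = ennreal (\<integral>t. f t + K \<partial>R)"
        using int pos order_trans[OF zero_le_one pos] by (intro nn_integral_eq_integral) auto
      then show "(\<integral>\<^sup>+t. ennreal (f t + K) \<partial>R) = ennreal ((\<integral>t. f t \<partial>R) + K)" by (simp only: eq)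
      have "(\<integral>t. 1 \<partial>R) \<le> (\<integral>t. f t + K \<partial>R)" using int pos by (intro integral_mono) auto
      then show "0 < (\<integral>t. f t \<partial>R) + K" using eq by (simp add: prob_space)
    qed
    have "continuous_on UNIV (\<lambda>t. ennreal (f t + K))"
      using f(1) by (intro continuous_on_ennreal continuous_intros)
    from nn_integral_otree_le_liminf[OF this P(2) Q(2) cyl]
    have "ennreal ((\<integral>t. f t \<partial>Q) + K) \<le> liminf (\<lambda>n. ennreal ((\<integral>t. f t \<partial>P n) + K))"
      by (simp add: shift P Q)
    moreover have "ennreal (a + K) < ennreal ((\<integral>t. f t \<partial>Q) + K)"
      using a shift(2)[OF Q] by (intro ennreal_lessI) auto
    ultimately have "ennreal (a + K) < liminf (\<lambda>n. ennreal ((\<integral>t. f t \<partial>P n) + K))" by simp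
    then have "eventually (\<lambda>n. ennreal (a + K) < ennreal ((\<integral>t. f t \<partial>P n) + K)) sequentially"
      by (rule less_LiminfD)
    then show ?thesis
      by eventually_elim (metis add_le_cancel_right ennreal_leI linorder_not_less)
  qed
  fix f :: "otree \<Rightarrow> real" assume f: "continuous_on UNIV f" "bounded (range f)"
  show "(\<lambda>n. \<integral>t. f t \<partial>P n) \<longlonglongrightarrow> (\<integral>t. f t \<partial>Q)"
  proof (rule order_tendstoI)
    fix a assume "a < (\<integral>t. f t \<partial>Q)"
    then show "eventually (\<lambda>n. a < (\<integral>t. f t \<partial>P n)) sequentially" by (rule low[OF f])
  next
    fix a assume "(\<integral>t. f t \<partial>Q) < a"
    then have "eventually (\<lambda>n. - a < (\<integral>t. - f t \<partial>P n)) sequentially"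
      using f by (intro low) (auto simp: bounded_iff intro!: continuous_intros)
    then show "eventually (\<lambda>n. (\<integral>t. f t \<partial>P n) < a) sequentially" by simp
  qed
qed

section \<open>Conditioning on a monotone functional\<close>

lemma uniform_measure_distr:
  assumes [measurable]: "f \<in> borel_measurable M" and "X \<in> sets borel"
  shows "distr (uniform_measure M (f -` X \<inter> space M)) borel f = uniform_measure (distr M borel f) X"
proof (rule measure_eqI)
  fix Y assume "Y \<in> sets (distr (uniform_measure M (f -` X \<inter> space M)) borel f)"
  then have Y: "Y \<in> sets borel" by simp
  have "f -` X \<inter> space M \<in> sets M" "f -` Y \<inter> space M \<in> sets M"
    using assms Y by (auto intro: measurable_sets)
  moreover have "f \<in> borel_measurable (uniform_measure M (f -` X \<inter> space M))"
    using assms(1) by (simp cong: measurable_cong_sets)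
  moreover have "f -` X \<inter> space M \<inter> (f -` Y \<inter> space M) = f -` (X \<inter> Y) \<inter> space M" by auto
  ultimately show "emeasure (distr (uniform_measure M (f -` X \<inter> space M)) borel f) Y
      = emeasure (uniform_measure (distr M borel f) X) Y"
    using assms(2) Y by (simp add: emeasure_distr)
qed simp

context branching_law
begin

lemma prob_restr:
  assumes "restr h s = s"
  shows "prob {t. restr h t = s} = weight p h s"
  using prob_grafted[of UNIV h s] assms prob_space by (simp add: grafted_def)

text \<open>
  The assumption on \<open>B\<close> is the form in which monotonicity enters: a finite tree with a subtree in \<open>B\<close>
  belongs to \<open>B\<close>. The geometric sum equals \<open>(1 - (1 - q) ^ k) / q\<close> for \<open>q = prob B\<close>, and its limit at
  \<open>q = 0\<close> is visibly \<open>k\<close>.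
\<close>

lemma conditional_cylinder_ge:
  assumes "offspring_mean p = 1" "pmf p 1 \<noteq> 1"
    and B: "B \<subseteq> {t. finite_tree t}" "prob B > 0"
    and up: "\<And>t u. finite_tree t \<Longrightarrow> u \<in> nodes t \<Longrightarrow> subtree t u \<in> B \<Longrightarrow> t \<in> B"
    and s: "restr h s = s"
  shows "weight p h s * (\<Sum>j<level_size h s. (1 - prob B) ^ j) \<le> prob ({t. restr h t = s} \<inter> B) / prob B"
proof -
  let ?C = "{t. restr h t = s}" and ?F = "{t. finite_tree t}"
  have B_sets: "B \<in> sets borel" using B(1) by (rule finite_trees_sets)
  have "prob B \<le> prob ?F" using B by (intro finite_measure_mono) (auto intro!: finite_trees_sets)
  then have "prob ?F = 1" using B assms by (intro extinction) auto
  then have fin: "AE t in Q. finite_tree t"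
    using AE_prob_1[of ?F] by simp
  \<comment> \<open>A finite tree in the cylinder but outside \<open>B\<close> has no subtree above height \<open>h\<close> in \<open>B\<close>.\<close>
  have sub: "AE t in Q. t \<in> ?C \<longrightarrow> t \<in> (?C \<inter> B) \<union> grafted h s (- B)"
    using fin
  proof eventually_elim
    case (elim t)
    show ?case
    proof (intro impI)
      assume t: "t \<in> ?C"
      show "t \<in> (?C \<inter> B) \<union> grafted h s (- B)"
        using up[OF elim] t by (auto simp: grafted_def level_def)
    qed
  qed
  have "prob (- B) = 1 - prob B" using prob_compl[of B] B_sets by (simp add: Compl_eq_Diff_UNIV)
  then have gr: "prob (grafted h s (- B)) = weight p h s * (1 - prob B) ^ level_size h s"
    using prob_grafted[of "- B" h s] B_sets s by simp
  have gs: "grafted h s (- B) \<in> sets borel" using B_sets by (intro grafted_sets) auto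
  have "weight p h s = prob ?C" using prob_restr[OF s] by simp
  also have "\<dots> \<le> prob ((?C \<inter> B) \<union> grafted h s (- B))"
    using sub B_sets gs by (intro finite_measure_mono_AE) auto
  also have "\<dots> \<le> prob (?C \<inter> B) + prob (grafted h s (- B))"
    using B_sets gs by (intro measure_Un_le) auto
  finally have "weight p h s * (1 - (1 - prob B) ^ level_size h s) \<le> prob (?C \<inter> B)"
    using gr by (simp add: algebra_simps)
  moreover have "1 - (1 - prob B) ^ level_size h s
      = prob B * (\<Sum>j<level_size h s. (1 - prob B) ^ j)"
    using one_diff_power_eq[of "1 - prob B" "level_size h s"] by simp
  ultimately show ?thesis using B(2) by (simp add: field_simps)
qed

lemma weakly_converges_conditioned:
  assumes crit: "offspring_mean p = 1" "pmf p 1 \<noteq> 1"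
    and pos: "\<And>n. prob {t. finite_tree t \<and> A t > (n::nat)} > 0"
    and mono: "\<And>t u. finite_tree t \<Longrightarrow> u \<in> nodes t \<Longrightarrow> A (subtree t u) \<le> A t"
  shows "weakly_converges (\<lambda>n. uniform_measure Q {t. finite_tree t \<and> A t > n}) (immortal_tree_law p)"
proof -
  define B where "B n = {t. finite_tree t \<and> A t > n}" for n :: nat
  have B_fin: "B n \<subseteq> {t. finite_tree t}" for n by (auto simp: B_def)
  have B_sets: "B n \<in> sets borel" for n using B_fin by (rule finite_trees_sets)
  have B_pos: "prob (B n) > 0" for n using pos by (simp add: B_def)
  have B_up: "t \<in> B n" if "finite_tree t" "u \<in> nodes t" "subtree t u \<in> B n" for t u n
    using mono[OF that(1,2)] that by (auto simp: B_def)
  have "(\<lambda>n. prob (B n)) \<longlonglongrightarrow> prob (\<Inter>n. B n)"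
    using B_sets by (intro finite_Lim_measure_decseq) (auto simp: B_def decseq_def)
  \<comment> \<open>A tree \<open>t\<close> lies outside \<open>B n\<close> as soon as \<open>n \<ge> A t\<close>.\<close>
  moreover have "(\<Inter>n. B n) = {}" by (auto simp: B_def)
  ultimately have lim: "(\<lambda>n. prob (B n)) \<longlonglongrightarrow> 0" by simp
  interpret I: prob_space "immortal_tree_law p"
    unfolding immortal_tree_law_def
    by (intro prob_space.prob_space_distr prob_space_PiM measurable_immortal_tree)
       (rule measure_pmf.prob_space_axioms)
  have "emeasure (immortal_tree_law p) {t. restr h t = s}
      \<le> liminf (\<lambda>n. emeasure (uniform_measure Q (B n)) {t. restr h t = s})" for h s
  proof (cases "restr h s = s")
    case False
    then have "{t. restr h t = s} = {}" using restr_restr by blast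
    then show ?thesis by simp
  next
    case True
    let ?C = "{t. restr h t = s}"
    let ?a = "\<lambda>n. weight p h s * (\<Sum>j<level_size h s. (1 - prob (B n)) ^ j)"
    have "?a \<longlonglongrightarrow> weight p h s * (\<Sum>j<level_size h s. (1 - 0) ^ j)"
      by (intro tendsto_intros lim)
    then have "(\<lambda>n. ennreal (?a n)) \<longlonglongrightarrow> ennreal (real (level_size h s) * weight p h s)"
      by (intro tendsto_ennrealI) (simp add: mult.commute)
    then have "liminf (\<lambda>n. ennreal (?a n)) = ennreal (real (level_size h s) * weight p h s)"
      by (intro lim_imp_Liminf) simp_all
    moreover have "emeasure (immortal_tree_law p) ?C \<le> ennreal (real (level_size h s) * weight p h s)"
      using immortal_cylinder_le[OF crit(1), of h s]
      by (simp add: I.emeasure_eq_measure ennreal_leI)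
    moreover have "liminf (\<lambda>n. ennreal (?a n)) \<le> liminf (\<lambda>n. emeasure (uniform_measure Q (B n)) ?C)"
    proof (intro Liminf_mono always_eventually allI)
      fix n
      have "emeasure (uniform_measure Q (B n)) ?C = emeasure Q (B n \<inter> ?C) / emeasure Q (B n)"
        using B_sets by (intro emeasure_uniform_measure) auto
      also have "\<dots> = ennreal (prob (?C \<inter> B n) / prob (B n))"
        using B_pos by (simp add: emeasure_eq_measure divide_ennreal Int_commute)
      finally show "ennreal (?a n) \<le> emeasure (uniform_measure Q (B n)) ?C"
        using conditional_cylinder_ge[OF crit B_fin B_pos B_up True, of n] by (simp add: ennreal_leI)
    qed
    ultimately show ?thesis by simp
  qed
  moreover have "prob_space (uniform_measure Q (B n))" for n
    using B_pos[of n] by (intro prob_space_uniform_measure) (auto simp: emeasure_eq_measure)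
  ultimately have "weakly_converges (\<lambda>n. uniform_measure Q (B n)) (immortal_tree_law p)"
    by (intro weakly_converges_otreeI I.prob_space_axioms) (auto simp: immortal_tree_law_def)
  then show ?thesis by (simp add: B_def)
qed

end

theorem theorem2p1:
  fixes p :: "nat pmf" and M :: "'w measure" and \<tau> :: "'w \<Rightarrow> otree" and A :: "otree \<Rightarrow> nat"
  assumes critical: "offspring_mean p = 1" "pmf p 1 \<noteq> 1"
    and gw: "galton_watson_tree p M \<tau>"
    and pos: "\<And>n. measure M {\<omega> \<in> space M. finite_tree (\<tau> \<omega>) \<and> A (\<tau> \<omega>) > n} > 0"
    and mono: "\<And>t b i. finite_tree t \<Longrightarrow> 1 \<le> b \<Longrightarrow> 1 \<le> i \<Longrightarrow> i \<le> level_size b t \<Longrightarrow>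
                 A (subtree_above b i t) \<le> A t"
  shows "weakly_converges
           (\<lambda>n. distr (uniform_measure M {\<omega> \<in> space M. finite_tree (\<tau> \<omega>) \<and> A (\<tau> \<omega>) > n}) borel \<tau>)
           (immortal_tree_law p)"
proof -
  interpret branching_law "distr M borel \<tau>" p using gw by (rule galton_watson_branching_law)
  have meas: "\<tau> \<in> borel_measurable M" using gw by (simp add: galton_watson_tree_def)
  let ?B = "\<lambda>n. {t. finite_tree t \<and> A t > n}"
  have B: "?B n \<in> sets borel" for n by (rule finite_trees_sets) auto
  have pre: "\<tau> -` ?B n \<inter> space M = {\<omega> \<in> space M. finite_tree (\<tau> \<omega>) \<and> A (\<tau> \<omega>) > n}" for n
    by auto
  have "A (subtree t u) \<le> A t" if t: "finite_tree t" "u \<in> nodes t" for t u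
  proof (cases "u = []")
    case False
    then have b: "1 \<le> length u" by (cases u) auto
    have "u \<in> level (length u) t" using t by (simp add: level_def)
    from subtree_at_level[OF this b] show ?thesis using mono[OF t(1) b] by metis
  qed simp
  moreover have "prob (?B n) > 0" for n using pos by (simp only: measure_distr[OF meas B] pre)
  ultimately have "weakly_converges (\<lambda>n. uniform_measure (distr M borel \<tau>) (?B n)) (immortal_tree_law p)"
    by (intro weakly_converges_conditioned critical)
  then show ?thesis by (simp only: uniform_measure_distr[OF meas B, symmetric] pre)
qed

end
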